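(* If $r$ is a rotor type with two states, then $UD(r)$ is balanced.
   Context: A rotor type is an infinite periodic sequence $r=(r^{(1)},r^{(2)},\dots)$ of natural numbers (states), with period $|r|$, indices mod $|r|$; two rotor types are equivalent if one is obtained from the other by an injective relabeling of states. A two-state rotor type is written over the states $\{1,2\}$ with the convention $r^{(1)}=1$. A rotor-router network: a finite digraph, a source vertex, target vertices of outdegree $0$, and at each non-target vertex $v$ a periodic sequence $e_v^{(1)},e_v^{(2)},\dots$ of out-edges; a particle starts at the source, on its $n$-th visit to a non-target vertex $v$ leaves along $e_v^{(n)}$, and whenever it reaches a target it is returned to the source; the hitting sequence is the sequence of targets reached. The compressor network for a two-state $r$ has non-target vertices $1$ (source), $2,3$ and targets $4,5$. On the $n$-th departure: from vertex $1$ the particle goes to vertex $2$ if $r^{(n)}=1$ and to vertex $3$ if $r^{(n)}=2$; from vertex $2$, in variant $U$ it goes to vertex $1$ if $r^{(n)}=1$ and to target $4$ if $r^{(n)}=2$, in variant $D$ to target $4$ if $r^{(n)}=1$ and to vertex $1$ if $r^{(n)}=2$; from vertex $3$ likewise with target $5$ in variant $U$ or $D$. For $X,Y\in\{U,D\}$, $XY(r)$ denotes the hitting sequence of the network with variant $X$ at vertex $2$ and $Y$ at vertex $3$, with $4$ written as $1$ and $5$ as $2$. A two-state rotor type is balanced if its two states occur equally often in a period. *)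

theory Defs
  imports "HOL-Library.Infinite_Set"
begin

text \<open>
  Sequences are indexed from 0: \<open>r n\<close> is the paper's \<open>r\<^sup>(\<^sup>n\<^sup>+\<^sup>1\<^sup>)\<close>, and the first departure from a
  vertex uses index 0.  A period is any positive period, not necessarily the least one.
\<close>

definition is_period :: "(nat \<Rightarrow> 'a) \<Rightarrow> nat \<Rightarrow> bool" where
  "is_period r p \<longleftrightarrow> 0 < p \<and> (\<forall>n. r (n + p) = r n)"

definition rotor_type :: "(nat \<Rightarrow> nat) \<Rightarrow> bool" where
  "rotor_type r \<longleftrightarrow> (\<exists>p. is_period r p)"

definition two_state_rotor_type :: "(nat \<Rightarrow> nat) \<Rightarrow> bool" where
  "two_state_rotor_type r \<longleftrightarrow> rotor_type r \<and> range r = {1, 2} \<and> r 0 = 1"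

text \<open>
  Balancedness is invariant under swapping the states 1 and 2, so it is not required here that the
  first state be 1: a hitting sequence is considered up to relabelling and may well start with 2.
\<close>

definition balanced :: "(nat \<Rightarrow> nat) \<Rightarrow> bool" where
  "balanced s \<longleftrightarrow> rotor_type s \<and> range s = {1, 2} \<and>
     (\<forall>p. is_period s p \<longrightarrow> card {i. i < p \<and> s i = 1} = card {i. i < p \<and> s i = 2})"

text \<open>
  \<open>out N v n\<close> is the head of the edge along which the particle leaves the non-target vertex \<open>v\<close>
  on its departure number \<open>n\<close>; the values of \<open>out N\<close> at targets are never used.
\<close>

record 'v rotor_network =
  source :: 'v
  targets :: "'v set"
  out :: "'v \<Rightarrow> nat \<Rightarrow> 'v"

text \<open>A state is the position of the particle together with the number of past departures from
  each vertex.\<close>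

fun step :: "'v rotor_network \<Rightarrow> 'v \<times> ('v \<Rightarrow> nat) \<Rightarrow> 'v \<times> ('v \<Rightarrow> nat)" where
  "step N (v, c) =
     (if v \<in> targets N then (source N, c) else (out N v (c v), c(v := c v + 1)))"

definition state_at :: "'v rotor_network \<Rightarrow> nat \<Rightarrow> 'v \<times> ('v \<Rightarrow> nat)" where
  "state_at N t = (step N ^^ t) (source N, \<lambda>_. 0)"

definition hitting_times :: "'v rotor_network \<Rightarrow> nat set" where
  "hitting_times N = {t. fst (state_at N t) \<in> targets N}"

text \<open>This is meaningful if \<open>hitting_times N\<close> is infinite, which is shown below for the compressor
  networks.\<close>

definition hitting_sequence :: "'v rotor_network \<Rightarrow> nat \<Rightarrow> 'v" where
  "hitting_sequence N n = fst (state_at N (enumerate (hitting_times N) n))"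

datatype variant = U | D

fun return_state :: "variant \<Rightarrow> nat" where
  "return_state U = 1"
| "return_state D = 2"

definition compressor :: "variant \<Rightarrow> variant \<Rightarrow> (nat \<Rightarrow> nat) \<Rightarrow> nat rotor_network" where
  "compressor X Y r =
     \<lparr> source = 1,
       targets = {4, 5},
       out = (\<lambda>v n.
         if v = 1 then (if r n = 1 then 2 else 3)
         else if v = 2 then (if r n = return_state X then 1 else 4)
         else (if r n = return_state Y then 1 else 5)) \<rparr>"

definition compress :: "variant \<Rightarrow> variant \<Rightarrow> (nat \<Rightarrow> nat) \<Rightarrow> nat \<Rightarrow> nat" where
  "compress X Y r n = (if hitting_sequence (compressor X Y r) n = 4 then 1 else 2)"

lemma infinite_hitting_times_compressor:
  assumes "two_state_rotor_type r"
  shows "infinite (hitting_times (compressor X Y r))"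
proof
  define N where "N = compressor X Y r"
  define pos where "pos t = fst (state_at N t)" for t
  define cnt where "cnt t = snd (state_at N t)" for t
  assume "finite (hitting_times (compressor X Y r))"
  then obtain T where "\<forall>t\<in>hitting_times N. t < T"
    unfolding finite_nat_set_iff_bounded N_def by blast
  then have T: "pos t \<notin> {4, 5}" if "t \<ge> T" for t
    using that by (force simp: hitting_times_def pos_def N_def compressor_def)
  have st: "state_at N (Suc t) = step N (pos t, cnt t)" for t
    by (simp add: state_at_def pos_def cnt_def)
  have tg: "targets N = {4, 5}" and sr: "source N = 1"
    by (simp_all add: N_def compressor_def)
  have step_pos: "pos (Suc t) = out N (pos t) (cnt t (pos t))"
    and step_cnt: "cnt (Suc t) = (cnt t)(pos t := cnt t (pos t) + 1)" if "t \<ge> T" for t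
    using T[OF that] arg_cong[OF st[of t], of fst] arg_cong[OF st[of t], of snd]
    by (simp_all add: pos_def[of "Suc t"] cnt_def[of "Suc t"] tg)
  have pos5: "pos t \<in> {1, 2, 3, 4, 5}" for t
  proof (induction t)
    case 0
    show ?case by (simp add: pos_def state_at_def sr)
  next
    case (Suc t)
    have "pos (Suc t) = (if pos t \<in> {4, 5} then 1 else out N (pos t) (cnt t (pos t)))"
      using arg_cong[OF st[of t], of fst] by (simp add: pos_def[of "Suc t"] tg sr)
    then show ?case by (simp add: N_def compressor_def)
  qed
  have pos3: "pos t \<in> {1, 2, 3}" if "t \<ge> T" for t
    using pos5[of t] T[OF that] by auto
  have hits: "\<exists>k\<ge>m. r k \<noteq> return_state Z" for m Z
  proof -
    obtain p where p: "p > 0" "\<And>n. r (n + p) = r n"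
      using assms by (auto simp: two_state_rotor_type_def rotor_type_def is_period_def)
    have rg: "range r = {1, 2}" using assms by (simp add: two_state_rotor_type_def)
    have "(if Z = U then 2 else 1) \<in> range r" using rg by simp
    then obtain j where j: "r j = (if Z = U then 2 else 1)" by (metis rangeE)
    have "r (j + m * p) = r j"
    proof (induction m)
      case (Suc m)
      then show ?case using p(2)[of "j + m * p"] by (simp add: ac_simps)
    qed simp
    moreover have "j + m * p \<ge> m" using p(1) by (simp add: trans_le_add2)
    ultimately show ?thesis using j by (intro exI[of _ "j + m * p"]) (cases Z; auto)
  qed
  obtain k where k: "k \<ge> cnt T 2" "r k \<noteq> return_state X" using hits by blast
  obtain l where l: "l \<ge> cnt T 3" "r l \<noteq> return_state Y" using hits by blast
  have bound: "cnt (T + n) 2 \<le> k \<and> cnt (T + n) 3 \<le> l" for n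
  proof (induction n)
    case 0
    show ?case using k l by simp
  next
    case (Suc n)
    have A: "pos (T + n) = 2 \<Longrightarrow> cnt (T + n) 2 \<noteq> k"
      using step_pos[of "T + n"] T[of "Suc (T + n)"] k(2) by (auto simp: N_def compressor_def)
    have B: "pos (T + n) = 3 \<Longrightarrow> cnt (T + n) 3 \<noteq> l"
      using step_pos[of "T + n"] T[of "Suc (T + n)"] l(2) by (auto simp: N_def compressor_def)
    have C: "cnt (T + Suc n) = (cnt (T + n))(pos (T + n) := cnt (T + n) (pos (T + n)) + 1)"
      using step_cnt[of "T + n"] by simp
    show ?case unfolding C using Suc A B by auto
  qed
  have grow: "cnt (T + 2 * n) 2 + cnt (T + 2 * n) 3 \<ge> n" for n
  proof (induction n)
    case 0
    show ?case by simp
  next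
    case (Suc n)
    let ?t = "T + 2 * n"
    have two: "pos ?t = 1 \<Longrightarrow> pos (Suc ?t) \<in> {2, 3}"
      using step_pos[of ?t] by (simp add: N_def compressor_def)
    have c1: "cnt (Suc ?t) = (cnt ?t)(pos ?t := cnt ?t (pos ?t) + 1)" using step_cnt[of ?t] by simp
    have c2: "cnt (Suc (Suc ?t)) = (cnt (Suc ?t))(pos (Suc ?t) := cnt (Suc ?t) (pos (Suc ?t)) + 1)"
      using step_cnt[of "Suc ?t"] by simp
    have "T + 2 * Suc n = Suc (Suc ?t)" by simp
    moreover have "cnt (Suc (Suc ?t)) 2 + cnt (Suc (Suc ?t)) 3 \<ge> Suc n"
      using Suc two pos3[of ?t] unfolding c2 c1 by auto
    ultimately show ?case by metis
  qed
  show False using bound[of "2 * (k + l + 1)"] grow[of "k + l + 1"] by linarith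
qed

end

theory Submission
  imports Defs
begin

text \<open>
  Write \<open>A n\<close> and \<open>B n\<close> for the numbers of 1s and 2s among the first \<open>n\<close> terms of \<open>r\<close>.  After the
  particle has left vertex 1 for the \<open>n\<close>-th time and completed its excursion, vertices 2 and 3 have
  been used \<open>A n\<close> and \<open>B n\<close> times, so target 4 has been hit \<open>B (A n)\<close> times and target 5
  \<open>A (B n)\<close> times.  If \<open>r\<close> has period \<open>p\<close>, then \<open>n = p\<^sup>2\<close> makes all three counters multiples of \<open>p\<close>,
  so the network is back in its initial configuration, and both targets have been hit
  \<open>A p * B p\<close> times.
\<close>

section \<open>Counting occurrences in periodic sequences\<close>

definition occ :: "(nat \<Rightarrow> 'a) \<Rightarrow> 'a \<Rightarrow> nat \<Rightarrow> nat" where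
  "occ s x n = card {i. i < n \<and> s i = x}"

lemma occ_0 [simp]: "occ s x 0 = 0"
  by (simp add: occ_def)

lemma occ_Suc [simp]: "occ s x (Suc n) = occ s x n + (if s n = x then 1 else 0)"
proof -
  have "{i. i < Suc n \<and> s i = x} = (if s n = x then insert n else id) {i. i < n \<and> s i = x}"
    by (auto simp: less_Suc_eq)
  then show ?thesis by (simp add: occ_def)
qed

lemma occ_le: "occ s x n \<le> n"
  by (induction n) auto

lemma occ_add_period:
  assumes "is_period s p"
  shows "occ s x (m + p) = occ s x m + occ s x p"
  using assms by (induction m) (auto simp: is_period_def)

lemma occ_mult_period:
  assumes "is_period s p"
  shows "occ s x (k * p) = k * occ s x p"
proof (induction k)
  case (Suc k)
  then show ?case using occ_add_period[OF assms, of x "k * p"] by (simp add: add.commute)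
qed simp

lemma add_mult_period:
  assumes "is_period s p"
  shows "s (n + k * p) = s n"
proof (induction k)
  case (Suc k)
  have "s (n + k * p + p) = s (n + k * p)"
    using assms by (simp add: is_period_def)
  then show ?case using Suc by (simp add: ac_simps)
qed simp

lemma occ_pos_iff:
  assumes "is_period s p"
  shows "0 < occ s x p \<longleftrightarrow> x \<in> range s"
proof
  assume "x \<in> range s"
  then obtain i where "s i = x" by blast
  moreover have "s (i mod p + i div p * p) = s (i mod p)"
    by (rule add_mult_period[OF assms(1)])
  ultimately have "i mod p \<in> {i. i < p \<and> s i = x}"
    using assms by (simp add: is_period_def)
  then show "0 < occ s x p" unfolding occ_def by (auto simp: card_gt_0_iff)
qed (auto simp: occ_def card_gt_0_iff)

text \<open>A single period suffices: counting over \<open>p * q\<close> terms in two ways transfers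
  the equality from \<open>p\<close> to any other period \<open>q\<close>. Equal counts also force
  both states to occur, since \<open>s 0\<close> already makes one of them positive.\<close>

lemma balancedI:
  assumes period: "is_period s p"
    and range: "range s \<subseteq> {1, 2}"
    and occ: "occ s 1 p = occ s 2 p"
  shows "balanced s"
proof -
  have "s 0 \<in> {1, 2}" using range by blast
  then have "0 < occ s 1 p \<or> 0 < occ s 2 p"
    using occ_pos_iff[OF period, of "s 0"] by auto
  then have "1 \<in> range s" "2 \<in> range s"
    using occ by (simp_all flip: occ_pos_iff[OF period])
  moreover have "occ s 1 q = occ s 2 q" if "is_period s q" for q
  proof -
    have "p * occ s x q = q * occ s x p" for x
      using occ_mult_period[OF that, of x p] occ_mult_period[OF period, of x q]
      by (simp add: mult.commute)
    then have "p * occ s 1 q = p * occ s 2 q" using occ by simp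
    then show ?thesis using period by (simp add: is_period_def)
  qed
  ultimately show ?thesis
    using range period unfolding balanced_def rotor_type_def occ_def by blast
qed

section \<open>Thinning a sequence along an infinite set of times\<close>

context
  fixes H :: "nat set"
  assumes infinite: "infinite H"
begin

lemma occ_enumerate: "occ (\<lambda>t. t \<in> H) True (enumerate H n) = n"
proof -
  have "{t. t < enumerate H n \<and> t \<in> H} = enumerate H ` {..<n}"
  proof (intro equalityI subsetI)
    fix t assume t: "t \<in> {t. t < enumerate H n \<and> t \<in> H}"
    then obtain m where "t = enumerate H m"
      using enumerate_Ex[OF infinite, of t] by auto
    then show "t \<in> enumerate H ` {..<n}"
      using t infinite by simp
  qed (use infinite in \<open>auto simp: enumerate_in_set\<close>)
  then show ?thesis
    using infinite by (simp add: occ_def card_image inj_on_subset[OF inj_enumerate])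
qed

lemma enumerate_less_iff: "enumerate H n < T \<longleftrightarrow> n < occ (\<lambda>t. t \<in> H) True T"
proof -
  have mono: "occ (\<lambda>t. t \<in> H) True a \<le> occ (\<lambda>t. t \<in> H) True b" if "a \<le> b" for a b
    using that unfolding occ_def by (intro card_mono) auto
  show ?thesis
  proof (cases "enumerate H n < T")
    case True
    then show ?thesis
      using mono[of "Suc (enumerate H n)" T] infinite by (simp add: occ_enumerate enumerate_in_set)
  next
    case False
    then show ?thesis
      using mono[of T "enumerate H n"] by (simp add: occ_enumerate)
  qed
qed

text \<open>A shift by \<open>T\<close> keeps elements inside \<open>H\<close> and, by
  \<open>occ_add_period\<close>, raises the rank of each by the number of elements of
  \<open>H\<close> below \<open>T\<close>.\<close>

lemma enumerate_add_period:
  assumes "is_period (\<lambda>t. t \<in> H) T"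
  shows "enumerate H (n + occ (\<lambda>t. t \<in> H) True T) = enumerate H n + T"
proof -
  have "enumerate H n + T \<in> H"
    using assms infinite by (simp add: enumerate_in_set is_period_def)
  then obtain m where m: "enumerate H m = enumerate H n + T"
    using enumerate_Ex[OF infinite] by blast
  then have "m = occ (\<lambda>t. t \<in> H) True (enumerate H n + T)"
    using occ_enumerate[of m] by simp
  also have "\<dots> = n + occ (\<lambda>t. t \<in> H) True T"
    using occ_add_period[OF assms, of True "enumerate H n"] by (simp add: occ_enumerate)
  finally show ?thesis using m by simp
qed

text \<open>Every occurrence of \<open>x\<close> lies at a time in \<open>H\<close>, so the
  injection \<open>enumerate H\<close> matches the occurrences before and after thinning;
  \<open>enumerate_less_iff\<close> makes the two cut-offs correspond.\<close>

lemma occ_comp_enumerate: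
  assumes "\<And>t. f t = x \<Longrightarrow> t \<in> H"
  shows "occ (\<lambda>n. f (enumerate H n)) x (occ (\<lambda>t. t \<in> H) True T) = occ f x T"
proof -
  have "{t. t < T \<and> f t = x}
      = enumerate H ` {n. n < occ (\<lambda>t. t \<in> H) True T \<and> f (enumerate H n) = x}"
  proof (intro equalityI subsetI)
    fix t assume t: "t \<in> {t. t < T \<and> f t = x}"
    then obtain n where "t = enumerate H n"
      using assms[of t] enumerate_Ex[OF infinite, of t] by auto
    then show "t \<in> enumerate H ` {n. n < occ (\<lambda>t. t \<in> H) True T \<and> f (enumerate H n) = x}"
      using t by (simp add: enumerate_less_iff)
  qed (auto simp: enumerate_less_iff)
  then show ?thesis
    using infinite by (simp add: occ_def card_image inj_on_subset[OF inj_enumerate])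
qed

end

section \<open>Dynamics of rotor networks and of the UD compressor\<close>

lemma state_at_Suc: "state_at N (Suc t) = step N (state_at N t)"
  by (simp add: state_at_def)

text \<open>The counters never return to 0, but if each has advanced by a shift that its rotor
  cannot detect, the run from time \<open>T\<close> retraces the run from time 0.\<close>

lemma state_at_add_period:
  assumes "state_at N T = (source N, d)"
    and "\<And>v n. v \<notin> targets N \<Longrightarrow> out N v (n + d v) = out N v n"
  shows "state_at N (t + T) = (fst (state_at N t), \<lambda>v. snd (state_at N t) v + d v)"
proof (induction t)
  case 0
  show ?case using assms(1) by (simp add: state_at_def)
next
  case (Suc t)
  obtain v c where "state_at N t = (v, c)" by fastforce
  then show ?case using Suc assms(2) by (auto simp: state_at_Suc)
qed

text \<open>The correction terms account for a particle that has left vertex 1 but not yet vertex 2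
  or 3. Hits are counted through time \<open>t\<close> inclusive, because a counter is incremented
  in the same step that moves the particle onto a target. Vertex 2 (variant \<open>U\<close>)
  releases to its target on state 2, vertex 3 (variant \<open>D\<close>) on state 1.\<close>

lemma compressor_UD_invariant:
  assumes "range r = {1, 2}"
    and "state_at (compressor U D r) t = (v, c)"
  defines "pos \<equiv> \<lambda>t. fst (state_at (compressor U D r) t)"
  shows "v \<in> {1, 2, 3, 4, 5} \<and> (\<forall>w. w \<notin> {1, 2, 3} \<longrightarrow> c w = 0) \<and>
    occ r 1 (c 1) = c 2 + (if v = 2 then 1 else 0) \<and>
    occ r 2 (c 1) = c 3 + (if v = 3 then 1 else 0) \<and>
    occ pos 4 (Suc t) = occ r 2 (c 2) \<and> occ pos 5 (Suc t) = occ r 1 (c 3)"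
  using assms(2)
proof (induction t arbitrary: v c)
  case 0
  then show ?case by (auto simp: state_at_def compressor_def pos_def)
next
  case (Suc t)
  obtain u b where ub: "state_at (compressor U D r) t = (u, b)" by fastforce
  have vc: "(v, c) = step (compressor U D r) (u, b)"
    using Suc.prems ub by (simp add: state_at_Suc)
  have pos: "pos (Suc t) = v" using Suc.prems by (simp add: pos_def)
  have r: "r n = 1 \<or> r n = 2" for n using assms(1) by blast
  note IH = Suc.IH[OF ub]
  consider "u = 1" | "u = 2" | "u = 3" | "u \<in> {4, 5}" using IH by blast
  then show ?case
  proof cases
    case 1
    \<comment> \<open>Splitting off only the last position keeps \<open>occ pos _ (Suc t)\<close> in
      the form used by the induction hypothesis.\<close>
    then show ?thesis using IH vc r[of "b 1"] unfolding occ_Suc[of pos _ "Suc t"] pos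
      by (auto simp: compressor_def simp del: occ_Suc) (auto simp: occ_Suc)
  next
    case 2
    then show ?thesis using IH vc r[of "b 2"] unfolding occ_Suc[of pos _ "Suc t"] pos
      by (auto simp: compressor_def simp del: occ_Suc) (auto simp: occ_Suc)
  next
    case 3
    then show ?thesis using IH vc r[of "b 3"] unfolding occ_Suc[of pos _ "Suc t"] pos
      by (auto simp: compressor_def simp del: occ_Suc) (auto simp: occ_Suc)
  next
    case 4
    then show ?thesis using IH vc unfolding occ_Suc[of pos _ "Suc t"] pos
      by (auto simp: compressor_def simp del: occ_Suc)
  qed
qed

text \<open>Each hit uses up a departure from vertex 2 or 3, and each of these a departure from
  vertex 1; so the infinitely many hits force infinitely many departures from the source.\<close>

lemma departures_source_unbounded:
  assumes "two_state_rotor_type r"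
  shows "\<exists>t. m < snd (state_at (compressor U D r) t) 1"
proof -
  define N where "N = compressor U D r"
  define H where "H = hitting_times N"
  have H: "infinite H"
    using infinite_hitting_times_compressor[OF assms] by (simp add: H_def N_def)
  define t where "t = enumerate H m"
  obtain v c where vc: "state_at N t = (v, c)" by fastforce
  let ?pos = "\<lambda>t. fst (state_at N t)"
  have tH: "t \<in> H" using H by (simp add: t_def enumerate_in_set)
  have split: "occ (\<lambda>t. t \<in> H) True n = occ ?pos 4 n + occ ?pos 5 n" for n
    by (induction n) (auto simp: H_def hitting_times_def N_def compressor_def)
  have "Suc m = occ (\<lambda>t. t \<in> H) True (Suc t)"
    using occ_enumerate[OF H, of m] tH by (simp add: t_def)
  also have "\<dots> = occ r 2 (c 2) + occ r 1 (c 3)"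
    using compressor_UD_invariant[of r t v c] assms vc unfolding split
    by (simp add: two_state_rotor_type_def N_def)
  also have "\<dots> \<le> c 2 + c 3" using occ_le by (intro add_mono) auto
  also have "\<dots> \<le> occ r 1 (c 1) + occ r 2 (c 1)"
    using compressor_UD_invariant[of r t v c] assms vc
    by (simp add: two_state_rotor_type_def N_def)
  also have "\<dots> \<le> c 1"
  proof -
    have "occ r 1 n + occ r 2 n \<le> n" for n by (induction n) auto
    then show ?thesis .
  qed
  finally show ?thesis using vc by (auto simp: N_def intro!: exI[of _ t])
qed

text \<open>Just before the counter of vertex 1 first exceeds \<open>m\<close>, it equals
  \<open>m\<close> and the particle is at vertex 1, the only place where that counter moves.\<close>

lemma ex_at_source_with_departures:
  assumes "two_state_rotor_type r"
  shows "\<exists>t c. state_at (compressor U D r) t = (1, c) \<and> c 1 = m"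
proof -
  define N where "N = compressor U D r"
  define t where "t = (LEAST t. m < snd (state_at N t) 1)"
  have t: "m < snd (state_at N t) 1"
    using departures_source_unbounded[OF assms] unfolding t_def N_def by (rule LeastI_ex)
  then obtain u where u: "t = Suc u" by (cases t) (simp_all add: state_at_def)
  then have "\<not> m < snd (state_at N u) 1"
    unfolding t_def by (metis lessI not_less_Least)
  moreover obtain v c where vc: "state_at N u = (v, c)" by fastforce
  ultimately have "v = 1" "c 1 = m"
    using t u by (auto simp: state_at_Suc split: if_splits)
  then show ?thesis using vc N_def by blast
qed

theorem theorem5p2:
  fixes r :: "nat \<Rightarrow> nat"
  assumes "two_state_rotor_type r"
  shows "balanced (compress U D r)"
proof -
  define N where "N = compressor U D r"
  define H where "H = hitting_times N"
  define pos where "pos t = fst (state_at N t)" for t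
  have H: "infinite H"
    using infinite_hitting_times_compressor[OF assms] by (simp add: H_def N_def)
  have H_iff: "t \<in> H \<longleftrightarrow> pos t = 4 \<or> pos t = 5" for t
    by (auto simp: H_def hitting_times_def pos_def N_def compressor_def)
  have range_r: "range r = {1, 2}" using assms by (simp add: two_state_rotor_type_def)
  obtain p where p: "is_period r p"
    using assms by (auto simp: two_state_rotor_type_def rotor_type_def)
  define \<alpha> \<beta> where "\<alpha> = occ r 1 p" and "\<beta> = occ r 2 p"
  have pos_ab: "0 < \<alpha>" "0 < \<beta>"
    by (simp_all add: \<alpha>_def \<beta>_def occ_pos_iff[OF p] range_r)
  obtain T d where T: "state_at N T = (1, d)" and d1: "d 1 = p * p"
    using ex_at_source_with_departures[OF assms, of "p * p"] by (auto simp: N_def)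
  note inv = compressor_UD_invariant[OF range_r T[unfolded N_def], folded N_def, folded pos_def]
  \<comment> \<open>Vertex 1 is no target, so the invariant's counts through time \<open>T\<close>
    agree with the counts before \<open>T\<close>.\<close>
  have posT: "pos T = 1" by (simp add: pos_def T)
  have d2: "d 2 = \<alpha> * p" and d3: "d 3 = \<beta> * p"
    using inv occ_mult_period[OF p] by (simp_all add: d1 \<alpha>_def \<beta>_def mult.commute del: One_nat_def)
  have occ4: "occ pos 4 T = \<alpha> * \<beta>" and occ5: "occ pos 5 T = \<beta> * \<alpha>"
    using inv posT occ_mult_period[OF p]
    by (simp_all add: d2 d3 \<alpha>_def \<beta>_def)
  \<comment> \<open>\<open>state_at_add_period\<close> speaks of all non-targets, including numbers
    that are not vertices; their counters are 0.\<close>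
  have "p dvd d v" for v
  proof (cases "v \<in> {1, 2, 3}")
    case True
    then show ?thesis using d1 d2 d3 by auto
  next
    case False
    then show ?thesis using inv by simp
  qed
  then have "r (n + d v) = r n" for n v
    using add_mult_period[OF p] by (metis dvdE mult.commute)
  then have "out N v (n + d v) = out N v n" for v n
    by (simp add: N_def compressor_def)
  then have pos_period: "pos (t + T) = pos t" for t
    using state_at_add_period[of N T d t] T by (simp add: pos_def N_def compressor_def)
  \<comment> \<open>The number of hits in the first \<open>T\<close> steps will be a period of the
    hitting sequence.\<close>
  define Q where "Q = occ (\<lambda>t. t \<in> H) True T"
  have "0 < T" using occ_le[of pos 4 T] occ4 pos_ab by (auto intro: gr0I)
  then have H_period: "is_period (\<lambda>t. t \<in> H) T"
    by (simp add: is_period_def H_iff pos_period)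
  have "0 < occ pos 4 T" using occ4 pos_ab by simp
  then obtain t where "t < T" "pos t = 4" by (auto simp: occ_def card_gt_0_iff)
  then have "0 < Q"
    unfolding Q_def occ_def by (auto simp: card_gt_0_iff H_iff)
  define h where "h n = pos (enumerate H n)" for n
  have h_period: "h (n + Q) = h n" for n
    using enumerate_add_period[OF H H_period, of n] pos_period by (simp add: h_def Q_def)
  have h_range: "h n = 4 \<or> h n = 5" for n
    using enumerate_in_set[OF H, of n] H_iff by (simp add: h_def)
  have compress: "compress U D r n = (if h n = 4 then 1 else 2)" for n
    by (simp add: compress_def hitting_sequence_def h_def pos_def H_def N_def)
  have "occ h 4 Q = \<alpha> * \<beta>" "occ h 5 Q = \<alpha> * \<beta>"
    unfolding Q_def h_def using occ_comp_enumerate[OF H, of pos] occ4 occ5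
    by (simp_all add: H_iff mult.commute)
  \<comment> \<open>\<open>compress\<close> sends everything except 4 to 2, so
    \<open>h_range\<close> is what identifies the value 2 with hits of target 5.\<close>
  moreover have "compress U D r n = 1 \<longleftrightarrow> h n = 4" "compress U D r n = 2 \<longleftrightarrow> h n = 5" for n
    using h_range[of n] by (auto simp: compress)
  ultimately have "occ (compress U D r) 1 Q = occ (compress U D r) 2 Q"
    by (simp add: occ_def)
  moreover have "is_period (compress U D r) Q"
    using \<open>0 < Q\<close> h_period by (simp add: is_period_def compress)
  ultimately show ?thesis
    by (intro balancedI) (auto simp: compress)
qed

end
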